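(* Let $H$ be a $k$-uniform hypergraph, and let $e\in E(H)$ be an edge containing at least two core vertices. If $\lambda$ is an eigenvalue of $\mathcal{A}_{H-e}$, then $\lambda$ is an eigenvalue of $\mathcal{A}_H$.
   Context: A $k$-uniform hypergraph $H$ ($k\geqslant2$) has a finite vertex set $V(H)$ and an edge set $E(H)$ of $k$-element subsets of $V(H)$. A core vertex is a vertex of degree one (contained in exactly one edge). For an edge $e$ containing core vertices, $H-e$ is the $k$-uniform hypergraph with vertex set $V(H)$ minus the core vertices of $e$, and edge set $E(H)\setminus\{e\}$. The adjacency tensor $\mathcal{A}_H$ of a $k$-uniform hypergraph on $n$ vertices is the order $k$ dimension $n$ tensor with entries $\frac{1}{(k-1)!}$ at $(i_1,\ldots,i_k)$ if $\{i_1,\ldots,i_k\}\in E(H)$ and $0$ otherwise. For $x\in\mathbb{C}^n$, $(\mathcal{A}_Hx)_i=\sum_{i_2,\ldots,i_k}a_{ii_2\cdots i_k}x_{i_2}\cdots x_{i_k}$; $\lambda\in\mathbb{C}$ is an eigenvalue if $\mathcal{A}_Hx=\lambda x^{[k-1]}$ for some nonzero $x$, where $x^{[k-1]}=(x_1^{k-1},\ldots,x_n^{k-1})^\top$. *)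

theory Defs
  imports Complex_Main
begin

record 'a hypergraph =
  verts :: "'a set"
  edges :: "'a set set"

definition uniform_hypergraph :: "nat \<Rightarrow> 'a hypergraph \<Rightarrow> bool" where
  "uniform_hypergraph k H \<longleftrightarrow>
     2 \<le> k \<and> finite (verts H) \<and> (\<forall>e\<in>edges H. e \<subseteq> verts H \<and> card e = k)"

definition vertex_degree :: "'a hypergraph \<Rightarrow> 'a \<Rightarrow> nat" where
  "vertex_degree H v = card {e \<in> edges H. v \<in> e}"

definition core_vertex :: "'a hypergraph \<Rightarrow> 'a \<Rightarrow> bool" where
  "core_vertex H v \<longleftrightarrow> v \<in> verts H \<and> vertex_degree H v = 1"

definition delete_edge :: "'a hypergraph \<Rightarrow> 'a set \<Rightarrow> 'a hypergraph" where
  "delete_edge H e =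
     \<lparr>verts = verts H - {v \<in> e. core_vertex H v}, edges = edges H - {e}\<rparr>"

text \<open>A tensor of order \<open>k\<close> whose indices range over a finite set \<open>V\<close> (so of dimension
  \<open>card V\<close>) is a function on index lists; only its values on lists of length \<open>k\<close> over \<open>V\<close>
  matter. Vectors are functions of which only the values on \<open>V\<close> matter, so a vector is nonzero
  if some coordinate \<^emph>\<open>in \<open>V\<close>\<close> is nonzero.\<close>

definition tensor_apply ::
    "nat \<Rightarrow> 'a set \<Rightarrow> ('a list \<Rightarrow> complex) \<Rightarrow> ('a \<Rightarrow> complex) \<Rightarrow> 'a \<Rightarrow> complex" where
  "tensor_apply k V A x i =
     (\<Sum>js\<in>{js. set js \<subseteq> V \<and> length js = k - 1}. A (i # js) * prod_list (map x js))"

definition tensor_eigenvalue ::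
    "nat \<Rightarrow> 'a set \<Rightarrow> ('a list \<Rightarrow> complex) \<Rightarrow> complex \<Rightarrow> bool" where
  "tensor_eigenvalue k V A \<mu> \<longleftrightarrow>
     (\<exists>x. (\<exists>i\<in>V. x i \<noteq> 0) \<and> (\<forall>i\<in>V. tensor_apply k V A x i = \<mu> * x i ^ (k - 1)))"

definition adjacency_tensor :: "nat \<Rightarrow> 'a hypergraph \<Rightarrow> 'a list \<Rightarrow> complex" where
  "adjacency_tensor k H js =
     (if length js = k \<and> set js \<in> edges H then 1 / fact (k - 1) else 0)"

lemma uniform_hypergraph_delete_edge:
  assumes H: "uniform_hypergraph k H" and e: "e \<in> edges H"
  shows "uniform_hypergraph k (delete_edge H e)"
proof -
  have "v \<notin> f" if f: "f \<in> edges H" "f \<noteq> e" and v: "v \<in> e" "core_vertex H v" for f v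
  proof
    assume "v \<in> f"
    have "card {d \<in> edges H. v \<in> d} = 1"
      using v(2) unfolding core_vertex_def vertex_degree_def by (rule conjunct2)
    then obtain g where g: "{d \<in> edges H. v \<in> d} = {g}"
      by (rule card_1_singletonE)
    have "f \<in> {g}" unfolding g[symmetric] using f(1) \<open>v \<in> f\<close> by simp
    moreover have "e \<in> {g}" unfolding g[symmetric] using e v(1) by simp
    ultimately show False using f(2) by simp
  qed
  then have "f \<subseteq> verts H - {v \<in> e. core_vertex H v}" if "f \<in> edges H" "f \<noteq> e" for f
    using H that unfolding uniform_hypergraph_def by blast
  with H show ?thesis
    by (simp add: uniform_hypergraph_def delete_edge_def)
qed

end

theory Submission
  imports Defs
begin

text \<open>Extend an eigenvector of \<open>H - e\<close> by zero to the core vertices of \<open>e\<close>. A monomial of the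
  tensor of \<open>H\<close> that comes from \<open>e\<close> still contains a core vertex of \<open>e\<close> after the index \<open>i\<close>
  is taken out, since there are at least two of them, and hence vanishes; all other monomials are
  those of the tensor of \<open>H - e\<close>.\<close>

text \<open>Degree one makes the set of edges through \<open>v\<close> a singleton, and both
  \<open>e\<close> and \<open>f\<close> belong to it.\<close>

lemma edge_eq_if_core_vertex:
  assumes "core_vertex H v" "e \<in> edges H" "v \<in> e" "f \<in> edges H" "v \<in> f"
  shows "f = e"
proof -
  obtain g where g: "{d \<in> edges H. v \<in> d} = {g}"
    using assms(1) unfolding core_vertex_def vertex_degree_def
    by (elim conjE card_1_singletonE)
  have "e \<in> {g}" "f \<in> {g}"
    unfolding g[symmetric] using assms by simp_all
  then show ?thesis
    by simp
qed

lemma prod_list_map_eq_0: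
  fixes x :: "'a \<Rightarrow> 'b::semiring_1"
  assumes "v \<in> set js" "x v = 0"
  shows "prod_list (map x js) = 0"
  using assms by (induction js) auto

theorem theorem4p1:
  fixes H :: "'a hypergraph" and k :: nat and e :: "'a set" and \<mu> :: complex
  assumes "uniform_hypergraph k H"
    and "e \<in> edges H"
    and "card {v \<in> e. core_vertex H v} \<ge> 2"
    and "tensor_eigenvalue k (verts (delete_edge H e)) (adjacency_tensor k (delete_edge H e)) \<mu>"
  shows "tensor_eigenvalue k (verts H) (adjacency_tensor k H) \<mu>"
proof -
  define C where "C = {v \<in> e. core_vertex H v}"
  define V where "V = verts H"
  define W where "W = V - C"
  define H' where "H' = delete_edge H e"
  have k: "2 \<le> k" and fin: "finite V"
    using assms(1) by (auto simp: uniform_hypergraph_def V_def)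
  have card_C: "card C \<ge> 2"
    using assms(3) by (simp add: C_def)
  have "verts H' = W" and edges_H': "edges H' = edges H - {e}"
    by (simp_all add: H'_def delete_edge_def W_def V_def C_def)
  then obtain x where nz: "\<exists>i\<in>W. x i \<noteq> 0"
    and eig: "\<And>i. i \<in> W \<Longrightarrow> tensor_apply k W (adjacency_tensor k H') x i = \<mu> * x i ^ (k - 1)"
    using assms(4) by (auto simp: tensor_eigenvalue_def H'_def)
  define y where "y = (\<lambda>v. if v \<in> C then 0 else x v)"
  have y_C: "prod_list (map y js) = 0" if "v \<in> C" "v \<in> set js" for v js
    using that by (intro prod_list_map_eq_0[of v]) (simp_all add: y_def)
  have "tensor_apply k V (adjacency_tensor k H) y i = \<mu> * y i ^ (k - 1)" if i: "i \<in> V" for i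
  proof (cases "i \<in> C")
    case True
    \<comment> \<open>At a core vertex of \<open>e\<close> both sides of the eigenvalue equation are
      0. On the left, every summand vanishes: an index list starting with \<open>i\<close> can only
      come from the edge \<open>e\<close>.\<close>
    have "adjacency_tensor k H (i # js) * prod_list (map y js) = 0" for js
    proof (cases "set (i # js) \<in> edges H")
      case edge: True
      have "set (i # js) = e"
        using True edge assms(2) by (intro edge_eq_if_core_vertex[of H i]) (auto simp: C_def)
      \<comment> \<open>The bound 2 enters here: besides \<open>i\<close> there is another core
        vertex of \<open>e\<close>, which must occur in \<open>js\<close> and makes the monomial
        0.\<close>
      moreover have "\<not> C \<subseteq> {i}"
        using card_C card_mono[of "{i}" C] by auto
      ultimately obtain c where "c \<in> C" "c \<in> set js"
        by (auto simp: C_def)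
      then show ?thesis
        by (simp add: y_C)
    qed (simp add: adjacency_tensor_def)
    then have "tensor_apply k V (adjacency_tensor k H) y i = 0"
      unfolding tensor_apply_def by (intro sum.neutral) blast
    \<comment> \<open>The exponent is positive since \<open>k\<close> is at least 2;
      \<open>0 ^ 0\<close> would be 1.\<close>
    moreover have "y i ^ (k - 1) = 0"
      using True k by (simp add: y_def zero_power)
    ultimately show ?thesis
      by simp
  next
    case False
    then have iW: "i \<in> W"
      using i by (simp add: W_def)
    have "C \<noteq> {}"
      using card_C by auto
    \<comment> \<open>Lists over \<open>V\<close> that meet \<open>C\<close> contribute 0 through
      \<open>y\<close>; on the remaining lists, those over \<open>W\<close>, the two sums agree term
      by term.\<close>
    have "tensor_apply k V (adjacency_tensor k H) y i
        = tensor_apply k W (adjacency_tensor k H') x i"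
      unfolding tensor_apply_def
    proof (rule sum.mono_neutral_cong_right)
      show "finite {js. set js \<subseteq> V \<and> length js = k - 1}"
        using fin by (rule finite_lists_length_eq)
      show "{js. set js \<subseteq> W \<and> length js = k - 1} \<subseteq> {js. set js \<subseteq> V \<and> length js = k - 1}"
        by (auto simp: W_def)
      show "\<forall>js\<in>{js. set js \<subseteq> V \<and> length js = k - 1} - {js. set js \<subseteq> W \<and> length js = k - 1}.
          adjacency_tensor k H (i # js) * prod_list (map y js) = 0"
      proof
        fix js
        assume "js \<in> {js. set js \<subseteq> V \<and> length js = k - 1} - {js. set js \<subseteq> W \<and> length js = k - 1}"
        then obtain v where "v \<in> C" "v \<in> set js"
          by (auto simp: W_def)
        then show "adjacency_tensor k H (i # js) * prod_list (map y js) = 0"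
          by (simp add: y_C)
      qed
      fix js assume "js \<in> {js. set js \<subseteq> W \<and> length js = k - 1}"
      then have js: "set js \<subseteq> W"
        by simp
      \<comment> \<open>All indices lie in \<open>W\<close>, but \<open>e\<close> has a vertex in
        \<open>C\<close>, so deleting \<open>e\<close> does not change this tensor entry.\<close>
      then have "set (i # js) \<noteq> e"
        using iW \<open>C \<noteq> {}\<close> unfolding W_def C_def by auto
      then have "adjacency_tensor k H (i # js) = adjacency_tensor k H' (i # js)"
        by (simp add: adjacency_tensor_def edges_H')
      moreover have "map y js = map x js"
        using js by (auto simp: W_def y_def)
      ultimately show "adjacency_tensor k H (i # js) * prod_list (map y js)
          = adjacency_tensor k H' (i # js) * prod_list (map x js)"
        by (simp only:)
    qed
    then show ?thesis
      using eig[OF iW] False by (simp add: y_def)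
  qed
  \<comment> \<open>The nonzero coordinate of \<open>x\<close> lies in \<open>W\<close>, where
    \<open>y\<close> agrees with \<open>x\<close>.\<close>
  moreover have "\<exists>i\<in>V. y i \<noteq> 0"
    using nz by (auto simp: W_def y_def)
  ultimately show ?thesis
    unfolding tensor_eigenvalue_def V_def by blast
qed

end
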